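(* Let $R$ be a field, let $O$ and $O'$ be harmonious admissible monomial orderings on $R\langle x_1,\dots,x_n\rangle$, and let $\theta$ be the common (extendible) first ordering function of the associated functional decompositions of $O$ and $O'$. Let $G=\{g_1,\dots,g_m\}$ be a Gröbner Basis, with respect to $O$, for an ideal $J$ of $R\langle x_1,\dots,x_n\rangle$. Then $G'=\{\mathrm{in}_\theta(g_1),\dots,\mathrm{in}_\theta(g_m)\}$ is always a Gröbner Basis for the ideal $\mathrm{in}_\theta(J)$ with respect to the monomial ordering $O$.
   Context: Ideals are two-sided. Monomials are words in the noncommuting variables $x_1,\dots,x_n$; a term is a nonzero scalar times a monomial. A monomial ordering is admissible if $1<m$ for all monomials $m\neq 1$ and $m_1<m_2$ implies $\ell m_1 r<\ell m_2 r$ for all monomials $\ell,r$. $\mathrm{LM}$ and $\mathrm{LC}$ denote leading monomial and leading coefficient. Gröbner Basis: a set $G$ generating the ideal such that all S-polynomials involving members of $G$ reduce to zero using $G$. Here, for each overlap between the leading monomials of two (not necessarily distinct) polynomials $p_1,p_2$ (one leading monomial is a subword of the other, or a proper prefix of one equals a proper suffix of the other), written $\ell_1\mathrm{LM}(p_1)r_1=\ell_2\mathrm{LM}(p_2)r_2$ with monomials such that at least one of $\ell_1,\ell_2$ and at least one of $r_1,r_2$ is $1$, the S-polynomial is $\mathrm{LC}(p_2)\ell_1p_1r_1-\mathrm{LC}(p_1)\ell_2p_2r_2$. Reduction by $G$ means repeatedly subtracting multiples $c\,\mathrm{LC}(g)^{-1}u\,g\,v$ ($g\in G$, $u,v$ monomials)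 to cancel a term $c\,u\,\mathrm{LM}(g)\,v$. An ordering function is a function $\theta$ from the set of monomials to $\mathbb Z$; the $\theta$-value of a term is that of its monomial. A functional decomposition is a (possibly infinite) sequence $\Theta=\{\theta_1,\theta_2,\dots\}$ of ordering functions; it defines a monomial ordering $O$ if, for arbitrary monomials $m_1<m_2$ with respect to $O$, one has $\theta_i(m_1)<\theta_i(m_2)$ for some $i\ge1$ and $\theta_j(m_1)=\theta_j(m_2)$ for all $1\le j<i$. For a polynomial $p$, the initial $\mathrm{in}_\theta(p)$ is made up of those terms of $p$ that have maximal $\theta$-value; $p$ is $\theta$-homogeneous if $p=\mathrm{in}_\theta(p)$. An ordering function $\theta$ is extendible if, given any $\theta$-homogeneous polynomial $p$, any multiple $upv$ of $p$ by terms $u$ and $v$ is also $\theta$-homogeneous. Two monomial orderings are harmonious if there exist functional decompositions defining them respectively whose first ordering functions are identical and extendible; these are the associated functional decompositions used in the claim. The ideal $\mathrm{in}_\theta(J)$ is defined as follows: $p\in J$ if and only if $\mathrm{in}_\theta(p)\in\mathrm{in}_\theta(J)$.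
   Formalization: Adds that θ(m₁)<θ(m₂) implies θ(ℓm₁r)<θ(ℓm₂r); without it the claim fails (θ=min(deg,1), G={x²−1}). in_θ(J) is taken as the ideal generated by the initials of elements of J, since the stated equivalence is inconsistent in general. *)

theory Defs
  imports Main "HOL.Hull" "HOL-Library.Extended_Nat" "HOL-Library.Poly_Mapping"
begin

text \<open>
  The free monoid on \<open>'v\<close>: with this instance, the convolution product of
  \<^theory>\<open>HOL-Library.Poly_Mapping\<close> makes \<open>'v list \<Rightarrow>\<^sub>0 'a\<close> the free associative
  algebra over \<open>'a\<close> in the noncommuting variables \<open>'v\<close>.
\<close>

instantiation list :: (type) monoid_add
begin

definition zero_list :: "'a list" where "zero_list = []"

definition plus_list :: "'a list \<Rightarrow> 'a list \<Rightarrow> 'a list" where "plus_list = (@)"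

instance by standard (simp_all add: zero_list_def plus_list_def)

end

type_synonym 'v monom = "'v list"
type_synonym ('v, 'a) ncpoly = "'v list \<Rightarrow>\<^sub>0 'a"

abbreviation monomial :: "'v monom \<Rightarrow> ('v, 'a::field) ncpoly" where
  "monomial u \<equiv> Poly_Mapping.single u 1"

definition is_term :: "('v, 'a::field) ncpoly \<Rightarrow> bool" where
  "is_term t \<longleftrightarrow> (\<exists>u c. c \<noteq> 0 \<and> t = Poly_Mapping.single u c)"

definition two_sided_ideal :: "'r::ring_1 set \<Rightarrow> bool" where
  "two_sided_ideal I \<longleftrightarrow>
     0 \<in> I \<and> (\<forall>p\<in>I. \<forall>q\<in>I. p - q \<in> I) \<and> (\<forall>p\<in>I. \<forall>a. a * p \<in> I \<and> p * a \<in> I)"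


section \<open>Monomial orderings\<close>

text \<open>A monomial ordering is given by the set of pairs \<open>(m\<^sub>1, m\<^sub>2)\<close> with \<open>m\<^sub>1 < m\<^sub>2\<close>.\<close>

definition monomial_ordering :: "'v monom rel \<Rightarrow> bool" where
  "monomial_ordering ord \<longleftrightarrow> strict_linear_order_on UNIV ord"

definition admissible :: "'v monom rel \<Rightarrow> bool" where
  "admissible ord \<longleftrightarrow>
     (\<forall>m. m \<noteq> [] \<longrightarrow> ([], m) \<in> ord) \<and>
     (\<forall>m\<^sub>1 m\<^sub>2 l r. (m\<^sub>1, m\<^sub>2) \<in> ord \<longrightarrow> (l @ m\<^sub>1 @ r, l @ m\<^sub>2 @ r) \<in> ord)"

text \<open>Only meaningful for nonzero polynomials.\<close>

definition LM :: "'v monom rel \<Rightarrow> ('v, 'a::field) ncpoly \<Rightarrow> 'v monom" where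
  "LM ord p =
     (THE m. m \<in> Poly_Mapping.keys p \<and>
             (\<forall>m'\<in>Poly_Mapping.keys p. m' \<noteq> m \<longrightarrow> (m', m) \<in> ord))"

definition LC :: "'v monom rel \<Rightarrow> ('v, 'a::field) ncpoly \<Rightarrow> 'a" where
  "LC ord p = Poly_Mapping.lookup p (LM ord p)"


section \<open>Noncommutative Groebner bases\<close>

text \<open>
  \<open>overlap m\<^sub>1 m\<^sub>2 l\<^sub>1 r\<^sub>1 l\<^sub>2 r\<^sub>2\<close> implies \<open>l\<^sub>1 m\<^sub>1 r\<^sub>1 = l\<^sub>2 m\<^sub>2 r\<^sub>2\<close>. The first two cases are the
  subword overlaps; in the last two, the nonempty word \<open>w\<close> is a proper suffix of one
  monomial and a proper prefix of the other. Requiring only the equation and the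
  triviality of the cofactors would also admit placements in which the two monomials
  do not meet.
\<close>

definition overlap ::
    "'v monom \<Rightarrow> 'v monom \<Rightarrow> 'v monom \<Rightarrow> 'v monom \<Rightarrow> 'v monom \<Rightarrow> 'v monom \<Rightarrow> bool" where
  "overlap m\<^sub>1 m\<^sub>2 l\<^sub>1 r\<^sub>1 l\<^sub>2 r\<^sub>2 \<longleftrightarrow>
     (l\<^sub>1 = [] \<and> r\<^sub>1 = [] \<and> m\<^sub>1 = l\<^sub>2 @ m\<^sub>2 @ r\<^sub>2) \<or>
     (l\<^sub>2 = [] \<and> r\<^sub>2 = [] \<and> m\<^sub>2 = l\<^sub>1 @ m\<^sub>1 @ r\<^sub>1) \<or>
     (l\<^sub>1 = [] \<and> r\<^sub>2 = [] \<and> l\<^sub>2 \<noteq> [] \<and> r\<^sub>1 \<noteq> [] \<and> (\<exists>w. w \<noteq> [] \<and> m\<^sub>1 = l\<^sub>2 @ w \<and> m\<^sub>2 = w @ r\<^sub>1)) \<or>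
     (l\<^sub>2 = [] \<and> r\<^sub>1 = [] \<and> l\<^sub>1 \<noteq> [] \<and> r\<^sub>2 \<noteq> [] \<and> (\<exists>w. w \<noteq> [] \<and> m\<^sub>2 = l\<^sub>1 @ w \<and> m\<^sub>1 = w @ r\<^sub>2))"

definition S_polys ::
    "'v monom rel \<Rightarrow> ('v, 'a::field) ncpoly \<Rightarrow> ('v, 'a) ncpoly \<Rightarrow> ('v, 'a) ncpoly set" where
  "S_polys ord p\<^sub>1 p\<^sub>2 =
     {Poly_Mapping.single l\<^sub>1 (LC ord p\<^sub>2) * p\<^sub>1 * monomial r\<^sub>1
        - Poly_Mapping.single l\<^sub>2 (LC ord p\<^sub>1) * p\<^sub>2 * monomial r\<^sub>2 |
      l\<^sub>1 r\<^sub>1 l\<^sub>2 r\<^sub>2. overlap (LM ord p\<^sub>1) (LM ord p\<^sub>2) l\<^sub>1 r\<^sub>1 l\<^sub>2 r\<^sub>2}"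

definition reduction_step ::
    "'v monom rel \<Rightarrow> ('v, 'a::field) ncpoly set \<Rightarrow> ('v, 'a) ncpoly \<Rightarrow> ('v, 'a) ncpoly \<Rightarrow> bool" where
  "reduction_step ord G p q \<longleftrightarrow>
     (\<exists>g\<in>G. \<exists>u v c. g \<noteq> 0 \<and> c \<noteq> 0 \<and> c = Poly_Mapping.lookup p (u @ LM ord g @ v) \<and>
        q = p - Poly_Mapping.single u (c * inverse (LC ord g)) * g * monomial v)"

definition reduces_to ::
    "'v monom rel \<Rightarrow> ('v, 'a::field) ncpoly set \<Rightarrow> ('v, 'a) ncpoly \<Rightarrow> ('v, 'a) ncpoly \<Rightarrow> bool" where
  "reduces_to ord G = (reduction_step ord G)\<^sup>*\<^sup>*"

definition groebner_basis ::
    "'v monom rel \<Rightarrow> ('v, 'a::field) ncpoly set \<Rightarrow> ('v, 'a) ncpoly set \<Rightarrow> bool" where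
  "groebner_basis ord G J \<longleftrightarrow>
     two_sided_ideal hull G = J \<and>
     (\<forall>p\<^sub>1\<in>G - {0}. \<forall>p\<^sub>2\<in>G - {0}. \<forall>s\<in>S_polys ord p\<^sub>1 p\<^sub>2. reduces_to ord G s 0)"


section \<open>Ordering functions and initials\<close>

text \<open>
  A functional decomposition is a finite or infinite sequence
  \<open>\<Theta> 0, \<Theta> 1, \<dots>\<close> of length \<open>N\<close>, indexed from \<open>0\<close>; values beyond \<open>N\<close> are ignored.
\<close>

definition defines_ordering :: "enat \<Rightarrow> (nat \<Rightarrow> 'v monom \<Rightarrow> int) \<Rightarrow> 'v monom rel \<Rightarrow> bool" where
  "defines_ordering N \<Theta> ord \<longleftrightarrow>
     (\<forall>m\<^sub>1 m\<^sub>2. (m\<^sub>1, m\<^sub>2) \<in> ord \<longrightarrow>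
        (\<exists>i. enat i < N \<and> \<Theta> i m\<^sub>1 < \<Theta> i m\<^sub>2 \<and> (\<forall>j<i. \<Theta> j m\<^sub>1 = \<Theta> j m\<^sub>2)))"

definition initial :: "('v monom \<Rightarrow> int) \<Rightarrow> ('v, 'a::field) ncpoly \<Rightarrow> ('v, 'a) ncpoly" where
  "initial \<theta> p =
     (\<Sum>m | m \<in> Poly_Mapping.keys p \<and> (\<forall>m'\<in>Poly_Mapping.keys p. \<theta> m' \<le> \<theta> m).
        Poly_Mapping.single m (Poly_Mapping.lookup p m))"

definition homogeneous :: "('v monom \<Rightarrow> int) \<Rightarrow> ('v, 'a::field) ncpoly \<Rightarrow> bool" where
  "homogeneous \<theta> p \<longleftrightarrow> p = initial \<theta> p"

definition extendible :: "'a::field itself \<Rightarrow> ('v monom \<Rightarrow> int) \<Rightarrow> bool" where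
  "extendible _ \<theta> \<longleftrightarrow>
     (\<forall>(p :: ('v, 'a) ncpoly) u v.
        homogeneous \<theta> p \<and> is_term u \<and> is_term v \<longrightarrow> homogeneous \<theta> (u * p * v))"

text \<open>Two orderings are harmonious iff \<open>harmonious_via\<close> holds for some \<open>\<theta>\<close>.\<close>

definition harmonious_via ::
    "'a::field itself \<Rightarrow> ('v monom \<Rightarrow> int) \<Rightarrow> 'v monom rel \<Rightarrow> 'v monom rel \<Rightarrow> bool" where
  "harmonious_via R \<theta> ord ord' \<longleftrightarrow>
     (\<exists>N \<Theta> N' \<Theta>'.
        N > 0 \<and> defines_ordering N \<Theta> ord \<and> \<Theta> 0 = \<theta> \<and>
        N' > 0 \<and> defines_ordering N' \<Theta>' ord' \<and> \<Theta>' 0 = \<theta>) \<and>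
     extendible R \<theta>"

text \<open>
  Extendibility alone does not give \<open>initial \<theta> (u * p * v) = u * initial \<theta> p * v\<close>:
  for a degree-lexicographic ordering, \<open>\<theta> m = min (length m) 1\<close> is a first ordering
  function and is extendible, but \<open>p = x\<^sup>2 - 1\<close> has initial \<open>x\<^sup>2\<close> whereas \<open>x * p\<close> is
  homogeneous. The condition below, satisfied by all (weighted) degree functions,
  rules this out.
\<close>

definition strictly_compatible :: "('v monom \<Rightarrow> int) \<Rightarrow> bool" where
  "strictly_compatible \<theta> \<longleftrightarrow>
     (\<forall>m\<^sub>1 m\<^sub>2 l r. \<theta> m\<^sub>1 < \<theta> m\<^sub>2 \<longrightarrow> \<theta> (l @ m\<^sub>1 @ r) < \<theta> (l @ m\<^sub>2 @ r))"

text \<open>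
  The ideal generated by the initials of \<open>J\<close>. The defining phrase ``\<open>p \<in> J\<close> if and only if
  \<open>initial \<theta> p\<close> lies in the ideal'' cannot be taken as an equivalence for all \<open>p\<close>, since
  polynomials inside and outside \<open>J\<close> may share the same initial.
\<close>

definition initial_ideal ::
    "('v monom \<Rightarrow> int) \<Rightarrow> ('v, 'a::field) ncpoly set \<Rightarrow> ('v, 'a) ncpoly set" where
  "initial_ideal \<theta> J = two_sided_ideal hull (initial \<theta> ` J)"

end

theory Submission
  imports Defs
begin

text \<open>
  Taking initials preserves leading monomials and leading coefficients, so \<open>g\<^sub>1, g\<^sub>2\<close> and their
  initials have the same overlaps, and the S-polynomial of the initials is the part of
  \<open>\<theta>\<close>-value \<open>\<theta> M\<close> of the S-polynomial of \<open>g\<^sub>1, g\<^sub>2\<close>, where \<open>M\<close> is the overlap word. Projecting a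
  reduction to \<open>0\<close> by \<open>G\<close> onto that part gives a reduction to \<open>0\<close> by the initials. For the ideals,
  Buchberger's criterion writes each \<open>p \<in> J\<close> as a combination of multiples \<open>u g v\<close> whose leading
  monomials do not exceed that of \<open>p\<close>; the part of maximal \<open>\<theta>\<close>-value then expresses
  \<open>initial \<theta> p\<close> through the initials of \<open>G\<close>. The criterion needs the ordering to be well-founded,
  which for admissible orderings on a finite alphabet is a form of Higman's lemma.
\<close>

section \<open>Word multiples of noncommutative polynomials\<close>

lemma poly_mapping_eq_sum_singles:
  "p = (\<Sum>m\<in>Poly_Mapping.keys p. Poly_Mapping.single m (Poly_Mapping.lookup p m))"
proof (rule poly_mapping_eqI)
  fix k
  show "Poly_Mapping.lookup p k = Poly_Mapping.lookup
      (\<Sum>m\<in>Poly_Mapping.keys p. Poly_Mapping.single m (Poly_Mapping.lookup p m)) k"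
    by (simp add: lookup_sum lookup_single when_def in_keys_iff)
qed

text \<open>Every added term is a term of the fixed \<open>p\<close>, so the step may use that
  \<open>m\<close> occurs in \<open>p\<close>; \<open>rep_times_left\<close> and
  \<open>rep_times_right\<close> depend on this.\<close>

lemma poly_mapping_term_induct [case_names zero add]:
  fixes p :: "'b \<Rightarrow>\<^sub>0 'a::comm_monoid_add"
  assumes zero: "P 0"
    and add: "\<And>q m. P q \<Longrightarrow> m \<in> Poly_Mapping.keys p \<Longrightarrow>
      P (q + Poly_Mapping.single m (Poly_Mapping.lookup p m))"
  shows "P p"
proof -
  have "P (\<Sum>m\<in>A. Poly_Mapping.single m (Poly_Mapping.lookup p m))"
    if "finite A" "A \<subseteq> Poly_Mapping.keys p" for A
    using that
  proof (induction A rule: finite_induct)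
    case (insert x A)
    then have "P ((\<Sum>m\<in>A. Poly_Mapping.single m (Poly_Mapping.lookup p m)) +
        Poly_Mapping.single x (Poly_Mapping.lookup p x))"
      by (intro add) auto
    then show ?case
      using insert by (simp add: add.commute)
  qed (simp add: zero)
  from this[of "Poly_Mapping.keys p"] show ?thesis
    by (simp flip: poly_mapping_eq_sum_singles)
qed

abbreviation word_mult ::
    "'v monom \<Rightarrow> 'a::field \<Rightarrow> ('v, 'a) ncpoly \<Rightarrow> 'v monom \<Rightarrow> ('v, 'a) ncpoly" where
  "word_mult u c p v \<equiv> Poly_Mapping.single u c * p * monomial v"

lemma word_mult_single [simp]:
  "word_mult u c (Poly_Mapping.single m d) v = Poly_Mapping.single (u @ m @ v) (c * d)"
  by (simp add: mult_single plus_list_def)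

lemma word_mult_word_mult:
  "word_mult l a (word_mult u c p v) r = word_mult (l @ u) (a * c) p (v @ r)"
proof -
  have "word_mult l a (word_mult u c p v) r =
      (Poly_Mapping.single l a * Poly_Mapping.single u c) * p * (monomial v * monomial r)"
    by (simp only: mult.assoc)
  then show ?thesis
    by (simp add: mult_single plus_list_def)
qed

lemma word_mult_trivial [simp]:
  fixes p :: "('v, 'a::field) ncpoly"
  shows "word_mult [] 1 p [] = p"
proof -
  have "(monomial [] :: ('v, 'a) ncpoly) = 1"
    by (simp flip: zero_list_def)
  then show ?thesis by simp
qed

text \<open>Holds because the coefficients commute, so the scalar can pass from one side of
  \<open>p\<close> to the other.\<close>

lemma word_mult_Nil_left: "word_mult [] c p v = p * Poly_Mapping.single v c"
proof (induction p rule: poly_mapping_term_induct)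
  case (add q k)
  then show ?case
    by (simp add: distrib_right distrib_left)
      (simp add: mult_single plus_list_def mult.commute)
qed simp

lemma lookup_word_mult:
  "Poly_Mapping.lookup (word_mult u c p v) (u @ m @ v) = c * Poly_Mapping.lookup p m"
proof -
  \<comment> \<open>A separate \<open>q\<close> stands for the sum: unfolding \<open>p\<close>
    itself would also rewrite the coefficients, which are taken from \<open>p\<close>.\<close>
  have "Poly_Mapping.lookup (word_mult u c q v) (u @ m @ v) = c * Poly_Mapping.lookup q m"
    if "q = (\<Sum>k\<in>A. Poly_Mapping.single k (Poly_Mapping.lookup p k))" for q A
    unfolding that sum_distrib_left sum_distrib_right lookup_sum
    by (intro sum.cong refl) (simp add: lookup_single when_def)
  from this[OF poly_mapping_eq_sum_singles] show ?thesis .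
qed

lemma lookup_word_mult_eq_0:
  assumes "\<And>m. w \<noteq> u @ m @ v"
  shows "Poly_Mapping.lookup (word_mult u c p v) w = 0"
proof (induction p rule: poly_mapping_term_induct)
  case (add q m)
  then show ?case
    using assms[of m] by (simp add: distrib_left distrib_right lookup_add lookup_single when_def)
qed simp

lemma in_keys_word_multE:
  assumes "w \<in> Poly_Mapping.keys (word_mult u c p v)"
  obtains m where "w = u @ m @ v" "m \<in> Poly_Mapping.keys p"
  using assms lookup_word_mult_eq_0[of w u v c p] lookup_word_mult[of u c p v]
  by (metis in_keys_iff mult_zero_right)

section \<open>Admissible orderings are well-founded\<close>

locale admissible_ordering =
  fixes ord :: "'v monom rel"
  assumes monomial_ordering: "monomial_ordering ord"
    and admissible: "admissible ord"
begin

abbreviation less (infix "\<prec>" 50) where "x \<prec> y \<equiv> (x, y) \<in> ord"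
abbreviation less_eq (infix "\<preceq>" 50) where "x \<preceq> y \<equiv> x = y \<or> x \<prec> y"

lemma irrefl [simp]: "\<not> x \<prec> x"
  using monomial_ordering
  by (auto simp: monomial_ordering_def strict_linear_order_on_def irrefl_def)

lemma less_trans [trans]: "x \<prec> y \<Longrightarrow> y \<prec> z \<Longrightarrow> x \<prec> z"
  using monomial_ordering
  by (auto simp: monomial_ordering_def strict_linear_order_on_def dest: transD)

lemma less_linear: "x \<noteq> y \<Longrightarrow> x \<prec> y \<or> y \<prec> x"
  using monomial_ordering
  by (auto simp: monomial_ordering_def strict_linear_order_on_def total_on_def)

lemma context_mono: "x \<prec> y \<Longrightarrow> l @ x @ r \<prec> l @ y @ r"
  using admissible by (auto simp: admissible_def)

text \<open>Cancellation follows from linearity: \<open>y \<preceq> x\<close> would carry over to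
  the contexts.\<close>

lemma context_mono_iff: "l @ x @ r \<prec> l @ y @ r \<longleftrightarrow> x \<prec> y"
  by (metis context_mono less_linear less_trans irrefl)

lemma Nil_less: "x \<noteq> [] \<Longrightarrow> [] \<prec> x"
  using admissible by (auto simp: admissible_def)

lemma less_Cons: "x \<prec> a # x"
  using context_mono[OF Nil_less[of "[a]"], of "[]" x] by simp

lemma finite_has_least:
  assumes "finite A" "A \<noteq> {}"
  shows "\<exists>m\<in>A. \<forall>x\<in>A. m \<preceq> x"
  using assms
proof (induction A rule: finite_ne_induct)
  case (insert x A)
  then obtain m where m: "m \<in> A" "\<forall>x\<in>A. m \<preceq> x" by blast
  show ?case
  proof (cases "m \<preceq> x")
    case True
    with m show ?thesis by auto
  next
    case False
    then have "x \<prec> m" using less_linear by auto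
    then have "\<forall>y\<in>A. x \<preceq> y"
      using m(2) less_trans[of x m] by auto
    then show ?thesis by auto
  qed
qed simp

lemma finite_has_greatest:
  assumes "finite A" "A \<noteq> {}"
  shows "\<exists>m\<in>A. \<forall>x\<in>A. x \<preceq> m"
  using assms
proof (induction A rule: finite_ne_induct)
  case (insert x A)
  then obtain m where m: "m \<in> A" "\<forall>x\<in>A. x \<preceq> m" by blast
  show ?case
  proof (cases "x \<preceq> m")
    case True
    with m show ?thesis by auto
  next
    case False
    then have "m \<prec> x" using less_linear by auto
    then have "\<forall>y\<in>A. y \<preceq> x"
      using m(2) less_trans[of _ m x] by auto
    then show ?thesis by auto
  qed
qed simp

text \<open>
  A minimal-bad-sequence argument. Let \<open>S\<close> be the non-accessible words and \<open>R\<close> the words of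
  \<open>S\<close> with no shorter word of \<open>S\<close> below them. By finiteness of the alphabet, the words of \<open>R\<close>
  with some fixed head \<open>a\<close> are coinitial in \<open>R\<close>; then deleting \<open>a\<close> from them yields a set
  without minimal element, hence a word of \<open>S\<close> contradicting the choice of \<open>R\<close>.
\<close>

lemma wf_ord:
  assumes "finite (UNIV :: 'v set)"
  shows "wf ord"
proof (rule ccontr)
  define no_min where "no_min Q \<longleftrightarrow> (\<forall>z\<in>Q. \<exists>y\<in>Q. y \<prec> z)" for Q
  \<comment> \<open>A union of sets without minimal element has none either, so \<open>S\<close> is
    the largest such set.\<close>
  define S where "S = \<Union> {Q. no_min Q}"
  assume "\<not> wf ord"
  then obtain Q x0 where "x0 \<in> Q" "no_min Q"
    unfolding wf_eq_minimal no_min_def by (metis (no_types))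
  then have x0: "x0 \<in> S" unfolding S_def by auto
  have S_below: "\<exists>y\<in>S. y \<prec> x" if x: "x \<in> S" for x
  proof -
    obtain Q where Q: "x \<in> Q" "no_min Q"
      using x unfolding S_def by auto
    then have "Q \<subseteq> S" "\<exists>y\<in>Q. y \<prec> x"
      unfolding S_def no_min_def by auto
    then show ?thesis by auto
  qed
  define R where "R = {x\<in>S. \<forall>y\<in>S. y \<preceq> x \<longrightarrow> length x \<le> length y}"
  have R_below_eq: "\<exists>y\<in>R. y \<preceq> x" if "x \<in> S" for x
  proof -
    \<comment> \<open>A shortest word of \<open>S\<close> among those \<open>\<preceq> x\<close>
      lies in \<open>R\<close>, since whatever is \<open>\<preceq> y\<close> is also
      \<open>\<preceq> x\<close>.\<close>
    define y where "y = arg_min length (\<lambda>y. y \<in> S \<and> y \<preceq> x)"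
    have y: "y \<in> S" "y \<preceq> x" and least: "\<And>z. z \<in> S \<Longrightarrow> z \<preceq> x \<Longrightarrow> length y \<le> length z"
      using arg_min_nat_lemma[of "\<lambda>y. y \<in> S \<and> y \<preceq> x" x length] that unfolding y_def by auto
    have "z \<preceq> x" if "z \<preceq> y" for z
      using that y(2) less_trans[of z y x] by auto
    then have "y \<in> R"
      unfolding R_def using y(1) least by simp
    with y show ?thesis by blast
  qed
  have R_below: "\<exists>y\<in>R. y \<prec> x" if x: "x \<in> R" for x
  proof -
    obtain y where "y \<in> S" "y \<prec> x" using S_below x by (auto simp: R_def)
    then show ?thesis using R_below_eq[of y] less_trans[of _ y x] by auto
  qed
  have Nil_notin: "[] \<notin> R"
  proof
    assume "[] \<in> R"
    then obtain y where "y \<prec> []" using R_below by blast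
    then show False
      using Nil_less[of y] less_trans[of "[]" y "[]"] by (cases "y = []") auto
  qed
  have "\<exists>a. \<forall>x\<in>R. \<exists>w. a # w \<in> R \<and> a # w \<prec> x"
  proof (rule ccontr)
    assume "\<not> ?thesis"
    \<comment> \<open>If every letter \<open>a\<close> failed, some \<open>f a\<close> in
      \<open>R\<close> would have no word of \<open>R\<close> with head \<open>a\<close> below it.
      The least \<open>m\<close> of the finitely many \<open>f a\<close> has a word of
      \<open>R\<close> below it, and for the head \<open>a\<close> of that word \<open>f a\<close>
      is contradicted.\<close>
    then have "\<forall>a. \<exists>x\<in>R. \<forall>w. a # w \<in> R \<longrightarrow> \<not> a # w \<prec> x" by auto
    then obtain f where "\<forall>a. f a \<in> R \<and> (\<forall>w. a # w \<in> R \<longrightarrow> \<not> a # w \<prec> f a)"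
      unfolding Bex_def by (auto dest: choice)
    then have f: "\<And>a. f a \<in> R" "\<And>a w. a # w \<in> R \<Longrightarrow> \<not> a # w \<prec> f a"
      by auto
    obtain m where m: "m \<in> range f" "\<forall>x\<in>range f. m \<preceq> x"
      using finite_has_least[of "range f"] assms by auto
    obtain y where y: "y \<in> R" "y \<prec> m"
      using R_below[of m] f(1) m(1) by auto
    obtain a w where "y = a # w"
      using y(1) Nil_notin by (cases y) auto
    moreover have "m \<preceq> f a" using m(2) by simp
    ultimately show False
      using y f(2)[of a w] less_trans[of y m "f a"] by auto
  qed
  then obtain a where a: "\<And>x. x \<in> R \<Longrightarrow> \<exists>w. a # w \<in> R \<and> a # w \<prec> x" by blast
  define T where "T = {w. a # w \<in> R}"
  have "no_min T"
    unfolding no_min_def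
  proof
    fix z assume "z \<in> T"
    then obtain w where "a # w \<in> R" "a # w \<prec> a # z"
      using a[of "a # z"] by (auto simp: T_def)
    then show "\<exists>y\<in>T. y \<prec> z"
      using context_mono_iff[of "[a]" w "[]" z] by (auto simp: T_def)
  qed
  obtain x w where "x \<in> R" and w: "a # w \<in> R"
    using R_below_eq[OF x0] a by metis
  \<comment> \<open>By maximality of \<open>S\<close>, \<open>T\<close> lies inside it. But
    \<open>w\<close> is shorter than \<open>a # w\<close> and below it, which membership of
    \<open>a # w\<close> in \<open>R\<close> forbids.\<close>
  then have "w \<in> S"
    using \<open>no_min T\<close> unfolding S_def by (auto simp: T_def)
  with w less_Cons[of w a] show False
    by (auto simp: R_def)
qed

section \<open>Leading monomials\<close>

lemma LM_greatest:
  assumes "p \<noteq> 0"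
  shows LM_in_keys: "LM ord p \<in> Poly_Mapping.keys p"
    and le_LM: "m \<in> Poly_Mapping.keys p \<Longrightarrow> m \<preceq> LM ord p"
proof -
  have "\<exists>m\<in>Poly_Mapping.keys p. \<forall>x\<in>Poly_Mapping.keys p. x \<preceq> m"
    using assms by (intro finite_has_greatest) auto
  then have "\<exists>!m. m \<in> Poly_Mapping.keys p \<and>
      (\<forall>m'\<in>Poly_Mapping.keys p. m' \<noteq> m \<longrightarrow> m' \<prec> m)"
    by (metis irrefl less_trans)
  from theI'[OF this] show "LM ord p \<in> Poly_Mapping.keys p"
    and "m \<in> Poly_Mapping.keys p \<Longrightarrow> m \<preceq> LM ord p"
    unfolding LM_def by blast+
qed

lemma LM_eqI:
  assumes "m \<in> Poly_Mapping.keys p" "\<And>m'. m' \<in> Poly_Mapping.keys p \<Longrightarrow> m' \<preceq> m"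
  shows "LM ord p = m"
proof -
  have "p \<noteq> 0" using assms(1) by auto
  then show ?thesis
    using assms LM_in_keys le_LM by (metis irrefl less_trans)
qed

lemma LC_nonzero: "p \<noteq> 0 \<Longrightarrow> LC ord p \<noteq> 0"
  using LM_in_keys by (auto simp: LC_def in_keys_iff)

lemma lookup_word_mult_LM:
  "Poly_Mapping.lookup (word_mult u c p v) (u @ LM ord p @ v) = c * LC ord p"
  by (simp add: LC_def lookup_word_mult)

lemma keys_word_mult_le:
  assumes "m \<in> Poly_Mapping.keys (word_mult u c p v)" "p \<noteq> 0"
  shows "m \<preceq> u @ LM ord p @ v"
  using assms by (metis in_keys_word_multE le_LM context_mono)

end

section \<open>Representations\<close>

text \<open>\<open>P\<close> restricts the words \<open>u @ LM ord g @ v\<close> of the summands,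
  not the words of the sum, where they may cancel. The vacuous \<open>P\<close> expresses ideal
  membership; the bound \<open>m \<preceq> LM ord p\<close> makes it a standard representation of
  \<open>p\<close>.\<close>

inductive rep ::
    "'v monom rel \<Rightarrow> ('v, 'a::field) ncpoly set \<Rightarrow> ('v monom \<Rightarrow> bool) \<Rightarrow> ('v, 'a) ncpoly \<Rightarrow> bool"
  for ord G P where
  zero: "rep ord G P 0"
| add: "rep ord G P p \<Longrightarrow> g \<in> G \<Longrightarrow> g \<noteq> 0 \<Longrightarrow> P (u @ LM ord g @ v) \<Longrightarrow>
    rep ord G P (p + word_mult u c g v)"

lemma rep_word_mult:
  "g \<in> G \<Longrightarrow> g \<noteq> 0 \<Longrightarrow> P (u @ LM ord g @ v) \<Longrightarrow> rep ord G P (word_mult u c g v)"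
  using rep.add[OF rep.zero] by fastforce

lemma rep_add:
  assumes "rep ord G P q" "rep ord G P p"
  shows "rep ord G P (p + q)"
  using assms(1) by induction (auto simp: assms(2) simp flip: add.assoc intro: rep.add)

lemma rep_context:
  assumes "rep ord G P p" "\<And>m. P m \<Longrightarrow> Q (l @ m @ r)"
  shows "rep ord G Q (word_mult l a p r)"
  using assms(1)
proof induction
  case (add p g u v c)
  have "rep ord G Q (word_mult l a p r + word_mult (l @ u) (a * c) g (v @ r))"
    using add assms(2)[of "u @ LM ord g @ v"] by (intro rep.add) auto
  then show ?case
    by (simp only: distrib_left distrib_right word_mult_word_mult)
qed (simp add: rep.zero)

lemma rep_scale: "rep ord G P p \<Longrightarrow> rep ord G P (word_mult [] c p [])"
  by (erule rep_context) simp

lemma rep_diff: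
  assumes "rep ord G P p" "rep ord G P q"
  shows "rep ord G P (p - q)"
proof -
  have "word_mult [] (- 1) q [] = - q"
    by (simp only: single_uminus mult_minus_left word_mult_trivial)
  with rep_add[OF rep_scale[OF assms(2), of "- 1"] assms(1)] show ?thesis by simp
qed

lemma rep_mono: "rep ord G P p \<Longrightarrow> (\<And>m. P m \<Longrightarrow> Q m) \<Longrightarrow> rep ord G Q p"
  by (induction rule: rep.induct) (auto intro: rep.intros)

lemma rep_times_left:
  assumes "rep ord G P p" "\<And>k m. k \<in> Poly_Mapping.keys a \<Longrightarrow> P m \<Longrightarrow> Q (k @ m)"
  shows "rep ord G Q (a * p)"
proof (induction a rule: poly_mapping_term_induct)
  case (add q m)
  have "rep ord G Q (word_mult m (Poly_Mapping.lookup a m) p [])"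
    using assms add by (intro rep_context[OF assms(1)]) auto
  from rep_add[OF this add(1)] show ?case
    using word_mult_trivial[of "Poly_Mapping.single m (Poly_Mapping.lookup a m) * p"]
    by (simp add: distrib_right mult.assoc flip: zero_list_def)
qed (simp add: rep.zero)

lemma rep_times_right:
  assumes "rep ord G P p" "\<And>k m. k \<in> Poly_Mapping.keys a \<Longrightarrow> P m \<Longrightarrow> Q (m @ k)"
  shows "rep ord G Q (p * a)"
proof (induction a rule: poly_mapping_term_induct)
  case (add q m)
  define c where "c = Poly_Mapping.lookup a m"
  have "rep ord G Q (word_mult [] c p m)"
    using assms add by (intro rep_context[OF assms(1)]) auto
  from rep_add[OF this add(1)] show ?case
    by (simp add: distrib_left c_def word_mult_Nil_left)
qed (simp add: rep.zero)

text \<open>The representable polynomials form an ideal containing \<open>G\<close>, and any ideal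
  containing \<open>G\<close> is closed under the steps that build them.\<close>

lemma hull_eq_rep: "two_sided_ideal hull G = {p. rep ord G (\<lambda>_. True) p}"
proof
  show "two_sided_ideal hull G \<subseteq> {p. rep ord G (\<lambda>_. True) p}"
  proof (rule hull_minimal)
    show "G \<subseteq> {p. rep ord G (\<lambda>_. True) p}"
    proof
      fix g assume "g \<in> G"
      then show "g \<in> {p. rep ord G (\<lambda>_. True) p}"
        using rep_word_mult[of g G "\<lambda>_. True" "[]" ord "[]" 1] by (cases "g = 0") (auto intro: rep.zero)
    qed
    show "two_sided_ideal {p. rep ord G (\<lambda>_. True) p}"
      unfolding two_sided_ideal_def
      by (auto intro: rep.zero rep_diff rep_times_left rep_times_right)
  qed
  show "{p. rep ord G (\<lambda>_. True) p} \<subseteq> two_sided_ideal hull G"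
  proof
    fix p assume "p \<in> {p. rep ord G (\<lambda>_. True) p}"
    then have "rep ord G (\<lambda>_. True) p" by simp
    moreover have "p \<in> I" if "rep ord G (\<lambda>_. True) p" "G \<subseteq> I" "two_sided_ideal I" for I
      using that(1)
    proof induction
      case (add p g u v c)
      have diff: "\<And>p q. p \<in> I \<Longrightarrow> q \<in> I \<Longrightarrow> p - q \<in> I" and zero: "0 \<in> I"
        and mult: "\<And>p a. p \<in> I \<Longrightarrow> a * p \<in> I \<and> p * a \<in> I"
        using that(3) unfolding two_sided_ideal_def by blast+
      have "word_mult u c g v \<in> I"
        using mult that(2) add(2) by blast
      \<comment> \<open>\<open>two_sided_ideal\<close> postulates differences only, so the sum is
        reached by subtracting a negative.\<close>
      with diff[OF zero this] add have "p - (0 - word_mult u c g v) \<in> I"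
        using diff by blast
      then show ?case by simp
    qed (use that in \<open>simp add: two_sided_ideal_def\<close>)
    ultimately show "p \<in> two_sided_ideal hull G"
      unfolding hull_def by blast
  qed
qed

section \<open>Buchberger's criterion\<close>

text \<open>Two occurrences in one word either meet, and then form an \<open>overlap\<close> once
  the common outer parts \<open>l\<close> and \<open>r\<close> are stripped, or one lies wholly to
  the left of the other.\<close>

lemma overlap_cases:
  assumes "u1 @ m1 @ v1 = u2 @ m2 @ v2"
  obtains (overlap) l r l1 r1 l2 r2 where "overlap m1 m2 l1 r1 l2 r2"
      "u1 = l @ l1" "v1 = r1 @ r" "u2 = l @ l2" "v2 = r2 @ r"
  | (before) w where "u2 = u1 @ m1 @ w" "v1 = w @ m2 @ v2"
  | (after) w where "u1 = u2 @ m2 @ w" "v2 = w @ m1 @ v1"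
proof -
  \<comment> \<open>\<open>Q\<close> omits the case \<open>after\<close>: it is proved when
    \<open>u2\<close> extends \<open>u1\<close>, and the other situation follows by exchanging the
    two occurrences.\<close>
  define Q where "Q u1 m1 v1 u2 m2 v2 \<longleftrightarrow>
      (\<exists>l r l1 r1 l2 r2. overlap m1 m2 l1 r1 l2 r2 \<and>
        u1 = l @ l1 \<and> v1 = r1 @ r \<and> u2 = l @ l2 \<and> v2 = r2 @ r) \<or>
      (\<exists>w. u2 = u1 @ m1 @ w \<and> v1 = w @ m2 @ v2)"
    for u1 m1 v1 u2 m2 v2 :: "'a list"
  have Q: "Q u1 m1 v1 (u1 @ t) m2 v2" if t: "m1 @ v1 = t @ m2 @ v2" for u1 m1 v1 t m2 v2
  proof -
    from t obtain w where "m1 = t @ w \<and> w @ v1 = m2 @ v2 \<or> m1 @ w = t \<and> v1 = w @ m2 @ v2"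
      unfolding append_eq_append_conv2 by auto
    then consider "m1 = t @ w" "w @ v1 = m2 @ v2" | "t = m1 @ w" "v1 = w @ m2 @ v2"
      by auto
    then show ?thesis
    proof cases
      case 1
      from 1(2) obtain x where "w = m2 @ x \<and> x @ v1 = v2 \<or> w @ x = m2 \<and> v1 = x @ v2"
        unfolding append_eq_append_conv2 by auto
      then consider (sub) "m1 = t @ m2 @ x" "v2 = x @ v1" | (suf) "m2 = w @ x" "v1 = x @ v2"
        using 1 by auto
      then show ?thesis
      proof cases
        case sub
        then have "overlap m1 m2 [] [] t x"
          by (simp add: overlap_def)
        with sub show ?thesis unfolding Q_def
          by (intro disjI1 exI[of _ u1] exI[of _ v1] exI[of _ "[]"] exI[of _ t] exI[of _ x]) simp
      next
        case suf
        show ?thesis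
        \<comment> \<open>With \<open>w\<close> empty the occurrences only touch, which is the case
          \<open>before\<close> with an empty gap. Otherwise they share \<open>w\<close>; if
          \<open>t\<close> or \<open>x\<close> is empty, this is a subword overlap.\<close>
        proof (cases "w = []")
          case True
          with 1 suf show ?thesis unfolding Q_def by auto
        next
          case False
          then have "overlap m1 m2 [] x t []"
            using 1 suf by (auto simp: overlap_def)
          with suf show ?thesis unfolding Q_def
            by (intro disjI1 exI[of _ u1] exI[of _ v2] exI[of _ "[]"] exI[of _ x] exI[of _ t]) simp
        qed
      qed
    next
      case 2
      then show ?thesis unfolding Q_def by auto
    qed
  qed
  from assms consider t where "u2 = u1 @ t" "m1 @ v1 = t @ m2 @ v2"
    | t where "u1 = u2 @ t" "m2 @ v2 = t @ m1 @ v1"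
    unfolding append_eq_append_conv2[of u1] by metis
  then show thesis
  proof cases
    case 1
    with Q[of m1 v1 t m2 v2 u1] show ?thesis
      unfolding Q_def using overlap before by auto
  next
    case 2
    have sym: "overlap m1 m2 l1 r1 l2 r2" if "overlap m2 m1 l2 r2 l1 r1" for l1 r1 l2 r2
      using that by (auto simp: overlap_def)
    from 2 Q[of m2 v2 t m1 v1 u2] show ?thesis
      unfolding Q_def using overlap[OF sym] after by auto
  qed
qed

section \<open>Bounds on representations, and exchange of multiples with the same leading
  word\<close>

context admissible_ordering
begin

lemma rep_keys:
  assumes "rep ord G P p" "k \<in> Poly_Mapping.keys p"
  shows "\<exists>m. P m \<and> k \<preceq> m"
  using assms
proof induction
  case (add p g u v c)
  from add.prems have "k \<in> Poly_Mapping.keys p \<or> k \<in> Poly_Mapping.keys (word_mult u c g v)"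
    using keys_add[of p "word_mult u c g v"] by auto
  then show ?case
    using add keys_word_mult_le[of k u c g v] by auto
qed simp

lemma rep_less_keys:
  assumes "rep ord G (\<lambda>m. m \<prec> M) p" "k \<in> Poly_Mapping.keys p"
  shows "k \<prec> M"
  using rep_keys[OF assms] less_trans[of k _ M] by auto

lemma rep_le_keys:
  assumes "rep ord G (\<lambda>m. m \<preceq> M) p" "k \<in> Poly_Mapping.keys p"
  shows "k \<preceq> M"
  using rep_keys[OF assms] less_trans[of k _ M] by auto

text \<open>A representation has finitely many summands, so the greatest of their words serves as
  \<open>M\<close>. This turns a strict bound into a non-strict one by a smaller word.\<close>

lemma rep_le_bound:
  assumes "rep ord G P p"
  shows "p = 0 \<or> (\<exists>M. P M \<and> rep ord G (\<lambda>m. m \<preceq> M) p)"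
  using assms
proof induction
  case (add p g u v c)
  define N where "N = u @ LM ord g @ v"
  have *: "rep ord G (\<lambda>m. m \<preceq> M) (word_mult u c g v)" if "N \<preceq> M" for M
    using add that by (intro rep_word_mult) (auto simp: N_def)
  show ?case
  proof (cases "p = 0")
    case True
    with *[of N] add show ?thesis by (auto simp: N_def)
  next
    case False
    then obtain M where M: "P M" "rep ord G (\<lambda>m. m \<preceq> M) p"
      using add by auto
    show ?thesis
    proof (cases "N \<preceq> M")
      case True
      from rep_add[OF *[OF this] M(2)] M(1) show ?thesis by blast
    next
      case False
      then have "M \<prec> N" using less_linear by auto
      then have "rep ord G (\<lambda>m. m \<preceq> N) p"
        using less_trans[of _ M N] by (auto intro: rep_mono[OF M(2)])
      from rep_add[OF *[of N] this] have "rep ord G (\<lambda>m. m \<preceq> N) (p + word_mult u c g v)"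
        by simp
      moreover have "P N" using add by (simp add: N_def)
      ultimately show ?thesis by blast
    qed
  qed
qed simp

lemma reduction_step_keys:
  assumes "reduction_step ord G p q" "k \<in> Poly_Mapping.keys q"
  shows "\<exists>m\<in>Poly_Mapping.keys p. k \<preceq> m"
proof -
  obtain g u v c where g: "g \<noteq> 0" "u @ LM ord g @ v \<in> Poly_Mapping.keys p"
    and q: "q = p - word_mult u (c * inverse (LC ord g)) g v"
    using assms(1) unfolding reduction_step_def by (auto simp: in_keys_iff)
  then show ?thesis
    using assms(2) keys_word_mult_le[OF _ g(1), of k u "c * inverse (LC ord g)" v]
      keys_diff[of p "word_mult u (c * inverse (LC ord g)) g v"] by auto
qed

text \<open>The subtracted multiples add up to \<open>p\<close>; each has its leading word among the
  words of the current polynomial, and these stay below \<open>M\<close> throughout.\<close>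

lemma reduces_to_0_rep:
  assumes "reduces_to ord G p 0" "\<And>k. k \<in> Poly_Mapping.keys p \<Longrightarrow> k \<prec> M"
  shows "rep ord G (\<lambda>m. m \<prec> M) p"
proof -
  have "(reduction_step ord G)\<^sup>*\<^sup>* p 0"
    using assms(1) by (simp add: reduces_to_def)
  then show ?thesis
    using assms(2)
  proof (induction rule: converse_rtranclp_induct)
    case (step p q)
    have "k \<prec> M" if "k \<in> Poly_Mapping.keys q" for k
      using reduction_step_keys[OF step(1) that] step(4) less_trans[of k _ M] by auto
    then have q: "rep ord G (\<lambda>m. m \<prec> M) q"
      using step(3) by blast
    obtain g u v c where g: "g \<in> G" "g \<noteq> 0" "u @ LM ord g @ v \<in> Poly_Mapping.keys p"
      and "q = p - word_mult u (c * inverse (LC ord g)) g v"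
      using step(1) unfolding reduction_step_def by (auto simp: in_keys_iff)
    then have "p = q + word_mult u (c * inverse (LC ord g)) g v" by simp
    then show ?case
      using rep.add[where P = "\<lambda>m. m \<prec> M", OF q g(1,2) step(4)[OF g(3)]] by simp
  qed (rule rep.zero)
qed

text \<open>Each multiple carries the leading coefficient of the other polynomial, so their
  coefficients at \<open>M\<close> agree and cancel.\<close>

lemma keys_cancel_less:
  assumes "g1 \<noteq> 0" "g2 \<noteq> 0" "u1 @ LM ord g1 @ v1 = M" "u2 @ LM ord g2 @ v2 = M"
    and "k \<in> Poly_Mapping.keys (word_mult u1 (LC ord g2) g1 v1 - word_mult u2 (LC ord g1) g2 v2)"
  shows "k \<prec> M"
proof -
  have "k \<in> Poly_Mapping.keys (word_mult u1 (LC ord g2) g1 v1) \<or>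
      k \<in> Poly_Mapping.keys (word_mult u2 (LC ord g1) g2 v2)"
    using assms(5) keys_diff[of "word_mult u1 (LC ord g2) g1 v1"] by auto
  then have "k \<preceq> M"
    using keys_word_mult_le[OF _ assms(1), of k u1 "LC ord g2" v1]
      keys_word_mult_le[OF _ assms(2), of k u2 "LC ord g1" v2] assms(3,4) by auto
  moreover have "Poly_Mapping.lookup
      (word_mult u1 (LC ord g2) g1 v1 - word_mult u2 (LC ord g1) g2 v2) M = 0"
    using lookup_word_mult_LM[of u1 "LC ord g2" g1 v1] lookup_word_mult_LM[of u2 "LC ord g1" g2 v2]
    by (simp add: lookup_minus assms(3,4) mult.commute)
  ultimately show ?thesis
    using assms(5) by (auto simp: in_keys_iff)
qed

lemma keys_tail_less:
  assumes "g \<noteq> 0" "k \<in> Poly_Mapping.keys (g - Poly_Mapping.single (LM ord g) (LC ord g))"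
  shows "k \<prec> LM ord g"
proof -
  have "k \<in> Poly_Mapping.keys g \<and> k \<noteq> LM ord g"
    using assms LM_in_keys
    by (auto simp: in_keys_iff lookup_minus lookup_single when_def LC_def split: if_splits)
  with le_LM[OF assms(1)] show ?thesis by auto
qed

text \<open>With \<open>t\<^sub>i\<close> the tail of \<open>g\<^sub>i\<close>, the two placements differ by \<open>t\<^sub>1 w g\<^sub>2 - g\<^sub>1 w t\<^sub>2\<close>.\<close>

lemma rep_disjoint:
  assumes "g1 \<in> G" "g1 \<noteq> 0" "g2 \<in> G" "g2 \<noteq> 0"
  shows "rep ord G (\<lambda>m. m \<prec> u @ LM ord g1 @ w @ LM ord g2 @ v)
    (word_mult u (LC ord g2) g1 (w @ LM ord g2 @ v) - word_mult (u @ LM ord g1 @ w) (LC ord g1) g2 v)"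
proof -
  define m1 m2 where "m1 = LM ord g1" and "m2 = LM ord g2"
  define t1 t2 where "t1 = g1 - Poly_Mapping.single m1 (LC ord g1)"
    and "t2 = g2 - Poly_Mapping.single m2 (LC ord g2)"
  have keys: "k \<in> Poly_Mapping.keys t1 \<Longrightarrow> k \<prec> m1" "k \<in> Poly_Mapping.keys t2 \<Longrightarrow> k \<prec> m2" for k
    using keys_tail_less assms(2,4) by (simp_all add: t1_def t2_def m1_def m2_def)
  have g: "rep ord G (\<lambda>m. m = LM ord g) g" if "g \<in> G" "g \<noteq> 0" for g
    using rep_word_mult[OF that, of "\<lambda>m. m = LM ord g" "[]" ord "[]" 1] by simp
  have "rep ord G (\<lambda>m. m \<prec> m1 @ w @ m2) ((t1 * monomial w) * g2)"
  proof (rule rep_times_left[OF g[OF assms(3,4)]])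
    fix k m assume "k \<in> Poly_Mapping.keys (t1 * monomial w)" "m = LM ord g2"
    moreover from this(1) obtain k1 where "k1 \<in> Poly_Mapping.keys t1" "k = k1 @ w"
      using keys_mult[of t1 "monomial w"] by (auto simp: plus_list_def)
    ultimately show "k @ m \<prec> m1 @ w @ m2"
      using context_mono[OF keys(1), of k1 "[]" "w @ m2"] by (simp add: m2_def)
  qed
  moreover have "rep ord G (\<lambda>m. m \<prec> m1 @ w @ m2) (g1 * (monomial w * t2))"
  proof (rule rep_times_right[OF g[OF assms(1,2)]])
    fix k m assume "k \<in> Poly_Mapping.keys (monomial w * t2)" "m = LM ord g1"
    moreover from this(1) obtain k2 where "k2 \<in> Poly_Mapping.keys t2" "k = w @ k2"
      using keys_mult[of "monomial w" t2] by (auto simp: plus_list_def)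
    ultimately show "m @ k \<prec> m1 @ w @ m2"
      using context_mono[OF keys(2), of k2 "m1 @ w" "[]"] by (simp add: m1_def)
  qed
  ultimately have tails: "rep ord G (\<lambda>m. m \<prec> m1 @ w @ m2)
      (t1 * monomial w * g2 - g1 * (monomial w * t2))"
    by (rule rep_diff)
  \<comment> \<open>Inserting the definitions of the tails, the two copies of
    \<open>g1 * monomial w * g2\<close> cancel.\<close>
  have "t1 * monomial w * g2 - g1 * (monomial w * t2) =
      g1 * (monomial w * Poly_Mapping.single m2 (LC ord g2)) -
      Poly_Mapping.single m1 (LC ord g1) * monomial w * g2"
    by (simp add: t1_def t2_def algebra_simps)
  also have "\<dots> = word_mult [] (LC ord g2) g1 (w @ m2) - word_mult (m1 @ w) (LC ord g1) g2 []"
  proof -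
    have "word_mult [] 1 (Poly_Mapping.single (m1 @ w) (LC ord g1) * g2) [] =
        Poly_Mapping.single (m1 @ w) (LC ord g1) * g2"
      by (rule word_mult_trivial)
    then have "word_mult (m1 @ w) (LC ord g1) g2 [] = Poly_Mapping.single (m1 @ w) (LC ord g1) * g2"
      by (simp add: mult.assoc[symmetric] mult_single plus_list_def)
    then show ?thesis
      by (simp add: word_mult_Nil_left mult_single plus_list_def)
  qed
  finally have D: "t1 * monomial w * g2 - g1 * (monomial w * t2) =
      word_mult [] (LC ord g2) g1 (w @ m2) - word_mult (m1 @ w) (LC ord g1) g2 []" .
  have "rep ord G (\<lambda>m. m \<prec> u @ m1 @ w @ m2 @ v)
    (word_mult u 1 (word_mult [] (LC ord g2) g1 (w @ m2) - word_mult (m1 @ w) (LC ord g1) g2 []) v)"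
  proof (rule rep_context[OF tails[unfolded D]])
    show "u @ m @ v \<prec> u @ m1 @ w @ m2 @ v" if "m \<prec> m1 @ w @ m2" for m
      using context_mono[OF that, of u v] by simp
  qed
  then show ?thesis
    by (simp only: right_diff_distrib left_diff_distrib word_mult_word_mult)
      (simp add: m1_def m2_def)
qed

text \<open>Overlapping occurrences give an S-polynomial placed in a context, which is representable
  because it reduces to 0; separated ones are handled by \<open>rep_disjoint\<close>.\<close>

lemma rep_cross:
  assumes S: "\<forall>p1\<in>G - {0}. \<forall>p2\<in>G - {0}. \<forall>s\<in>S_polys ord p1 p2. reduces_to ord G s 0"
    and g: "g1 \<in> G" "g1 \<noteq> 0" "g2 \<in> G" "g2 \<noteq> 0"
    and M: "u1 @ LM ord g1 @ v1 = M" "u2 @ LM ord g2 @ v2 = M"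
  shows "rep ord G (\<lambda>m. m \<prec> M)
    (word_mult u1 (LC ord g2) g1 v1 - word_mult u2 (LC ord g1) g2 v2)"
proof -
  have "u1 @ LM ord g1 @ v1 = u2 @ LM ord g2 @ v2" using M by simp
  then show ?thesis
  proof (cases rule: overlap_cases)
    case (overlap l r l1 r1 l2 r2)
    define N where "N = l1 @ LM ord g1 @ r1"
    have "l @ (l2 @ LM ord g2 @ r2) @ r = l @ N @ r"
      using M by (simp only: overlap(2-5) append_assoc N_def)
    then have N: "l2 @ LM ord g2 @ r2 = N"
      by (simp only: same_append_eq append_same_eq)
    define s where "s = word_mult l1 (LC ord g2) g1 r1 - word_mult l2 (LC ord g1) g2 r2"
    have "s \<in> S_polys ord g1 g2"
      unfolding S_polys_def s_def using overlap(1) by blast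
    then have "reduces_to ord G s 0" using S g by blast
    then have s: "rep ord G (\<lambda>m. m \<prec> N) s"
      using keys_cancel_less[OF g(2,4) _ N] by (intro reduces_to_0_rep) (auto simp: s_def N_def)
    have "rep ord G (\<lambda>m. m \<prec> M) (word_mult l 1 s r)"
      by (rule rep_context[OF s])
        (use M overlap context_mono[of _ N l r] in \<open>simp add: N_def\<close>)
    then show ?thesis
      unfolding s_def
      by (simp only: right_diff_distrib left_diff_distrib word_mult_word_mult)
        (simp add: overlap)
  next
    case (before w)
    then show ?thesis
      using rep_disjoint[OF g, of u1 w v2] M by simp
  next
    case (after w)
    then have "rep ord G (\<lambda>m. m \<prec> M)
      (word_mult u2 (LC ord g1) g2 v2 - word_mult u1 (LC ord g2) g1 v1)"
      using rep_disjoint[OF g(3,4,1,2), of u2 w v1] M by simp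
    from rep_diff[OF rep.zero this] show ?thesis by simp
  qed
qed

text \<open>By \<open>rep_cross\<close>, each summand with word \<open>M\<close> can be traded for a
  scalar multiple of one fixed summand; \<open>c\<close> collects these scalars.\<close>

lemma rep_le_modulo:
  assumes S: "\<forall>p1\<in>G - {0}. \<forall>p2\<in>G - {0}. \<forall>s\<in>S_polys ord p1 p2. reduces_to ord G s 0"
    and g0: "g0 \<in> G" "g0 \<noteq> 0" "u0 @ LM ord g0 @ v0 = M"
    and "rep ord G (\<lambda>m. m \<preceq> M) p"
  shows "\<exists>c. rep ord G (\<lambda>m. m \<prec> M) (p - word_mult u0 c g0 v0)"
  using assms(5)
proof induction
  case zero
  show ?case by (intro exI[of _ 0]) (simp add: rep.zero)
next
  case (add p g u v c)
  then obtain d where d: "rep ord G (\<lambda>m. m \<prec> M) (p - word_mult u0 d g0 v0)" by blast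
  show ?case
  proof (cases "u @ LM ord g @ v = M")
    case True
    \<comment> \<open>This scaling makes the coefficient of \<open>g\<close> in the cross difference
      equal to \<open>c\<close>.\<close>
    define e where "e = c / LC ord g0"
    have "rep ord G (\<lambda>m. m \<prec> M)
        (word_mult [] e (word_mult u (LC ord g0) g v - word_mult u0 (LC ord g) g0 v0) [])"
      by (rule rep_scale, rule rep_cross[OF S]) (use add g0 True in auto)
    then have "rep ord G (\<lambda>m. m \<prec> M) (word_mult u c g v - word_mult u0 (e * LC ord g) g0 v0)"
      using LC_nonzero[OF g0(2)]
      by (simp only: right_diff_distrib left_diff_distrib word_mult_word_mult)
        (simp add: e_def)
    from rep_add[OF this d] show ?thesis
      by (intro exI[of _ "d + e * LC ord g"]) (simp add: single_add algebra_simps)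
  next
    case False
    then have "rep ord G (\<lambda>m. m \<prec> M) (word_mult u c g v)"
      using add by (intro rep_word_mult) auto
    from rep_add[OF this d] show ?thesis
      by (intro exI[of _ d]) (simp add: algebra_simps)
  qed
qed

text \<open>Take the least bound \<open>M\<close> of a representation. If \<open>M\<close> did not
  occur in \<open>p\<close>, gathering the summands at \<open>M\<close> into one and comparing
  coefficients at \<open>M\<close> would force its scalar to vanish, leaving a strictly smaller
  bound. So \<open>M\<close> is the leading monomial.\<close>

lemma groebner_standard_rep:
  assumes wf: "wf ord"
    and S: "\<forall>p1\<in>G - {0}. \<forall>p2\<in>G - {0}. \<forall>s\<in>S_polys ord p1 p2. reduces_to ord G s 0"
    and p: "rep ord G (\<lambda>_. True) p" "p \<noteq> 0"
  shows "rep ord G (\<lambda>m. m \<preceq> LM ord p) p"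
proof -
  have "\<exists>M. rep ord G (\<lambda>m. m \<preceq> M) p"
    using rep_le_bound[OF p(1)] p(2) by simp
  then obtain M where M: "rep ord G (\<lambda>m. m \<preceq> M) p"
    and min: "\<And>N. N \<prec> M \<Longrightarrow> \<not> rep ord G (\<lambda>m. m \<preceq> N) p"
    using wfE_min'[OF wf, of "{M. rep ord G (\<lambda>m. m \<preceq> M) p}"] by auto
  have not_less: "\<not> rep ord G (\<lambda>m. m \<prec> M) p"
    using rep_le_bound[of G "\<lambda>m. m \<prec> M" p] p(2) min by auto
  have "M \<in> Poly_Mapping.keys p"
  proof (rule ccontr)
    assume "M \<notin> Poly_Mapping.keys p"
    show False
    proof (cases "\<exists>g\<in>G. g \<noteq> 0 \<and> (\<exists>u v. u @ LM ord g @ v = M)")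
      case True
      then obtain g u v where g: "g \<in> G" "g \<noteq> 0" "u @ LM ord g @ v = M" by blast
      obtain c where c: "rep ord G (\<lambda>m. m \<prec> M) (p - word_mult u c g v)"
        using rep_le_modulo[OF S g M] by auto
      then have "M \<notin> Poly_Mapping.keys (p - word_mult u c g v)"
        using rep_less_keys[OF c, of M] by auto
      then have "c * LC ord g = 0"
        using \<open>M \<notin> Poly_Mapping.keys p\<close> lookup_word_mult_LM[of u c g v] g(3)
        by (simp add: in_keys_iff lookup_minus)
      then have "c = 0" using LC_nonzero[OF g(2)] by simp
      with c not_less show False by simp
    next
      \<comment> \<open>No multiple of a generator has leading word \<open>M\<close>, so the bound
        is already strict.\<close>
      case False
      have "rep ord G (\<lambda>m. m \<prec> M) q" if "rep ord G (\<lambda>m. m \<preceq> M) q" for q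
        using that by induction (use False in \<open>auto intro: rep.intros\<close>)
      from this[OF M] not_less show False by contradiction
    qed
  qed
  then have "LM ord p = M"
    using rep_le_keys[OF M] by (intro LM_eqI) auto
  with M show ?thesis by simp
qed

end

section \<open>Initials\<close>

text \<open>Unlike \<open>initial\<close>, this projection is additive in \<open>p\<close> for fixed
  \<open>k\<close>, so it passes through sums and reductions.\<close>

definition theta_part :: "('v monom \<Rightarrow> int) \<Rightarrow> int \<Rightarrow> ('v, 'a::field) ncpoly \<Rightarrow> ('v, 'a) ncpoly" where
  "theta_part \<theta> k p =
     (\<Sum>m | m \<in> Poly_Mapping.keys p \<and> \<theta> m = k. Poly_Mapping.single m (Poly_Mapping.lookup p m))"

lemma lookup_theta_part:
  "Poly_Mapping.lookup (theta_part \<theta> k p) m = (if \<theta> m = k then Poly_Mapping.lookup p m else 0)"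
  by (auto simp: theta_part_def lookup_sum lookup_single when_def in_keys_iff)

lemma lookup_initial:
  "Poly_Mapping.lookup (initial \<theta> p) m =
     (if \<forall>m'\<in>Poly_Mapping.keys p. \<theta> m' \<le> \<theta> m then Poly_Mapping.lookup p m else 0)"
  by (auto simp: initial_def lookup_sum lookup_single when_def in_keys_iff)

lemma theta_part_0 [simp]: "theta_part \<theta> k 0 = 0"
  by (simp add: theta_part_def)

lemma theta_part_add: "theta_part \<theta> k (p + q) = theta_part \<theta> k p + theta_part \<theta> k q"
  by (rule poly_mapping_eqI) (simp add: lookup_theta_part lookup_add)

lemma theta_part_diff: "theta_part \<theta> k (p - q) = theta_part \<theta> k p - theta_part \<theta> k q"
  by (rule poly_mapping_eqI) (simp add: lookup_theta_part lookup_minus)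

lemma initial_0 [simp]: "initial \<theta> 0 = 0"
  by (simp add: initial_def)

lemma homogeneous_iff:
  "homogeneous \<theta> p \<longleftrightarrow> (\<forall>m\<in>Poly_Mapping.keys p. \<forall>m'\<in>Poly_Mapping.keys p. \<theta> m = \<theta> m')"
proof
  assume "homogeneous \<theta> p"
  then have p: "initial \<theta> p = p" by (simp add: homogeneous_def)
  have "\<theta> m' \<le> \<theta> m" if "m \<in> Poly_Mapping.keys p" "m' \<in> Poly_Mapping.keys p" for m m'
    using that lookup_initial[of \<theta> p m] unfolding p by (auto simp: in_keys_iff split: if_splits)
  then show "\<forall>m\<in>Poly_Mapping.keys p. \<forall>m'\<in>Poly_Mapping.keys p. \<theta> m = \<theta> m'"
    by (blast intro: order_antisym)
next
  assume *: "\<forall>m\<in>Poly_Mapping.keys p. \<forall>m'\<in>Poly_Mapping.keys p. \<theta> m = \<theta> m'"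
  have "initial \<theta> p = p"
  proof (rule poly_mapping_eqI)
    fix m
    show "Poly_Mapping.lookup (initial \<theta> p) m = Poly_Mapping.lookup p m"
    proof (cases "m \<in> Poly_Mapping.keys p")
      case True
      then have "\<forall>m'\<in>Poly_Mapping.keys p. \<theta> m' \<le> \<theta> m"
        using * by (metis order_refl)
      then show ?thesis by (simp add: lookup_initial)
    next
      case False
      then show ?thesis by (simp add: lookup_initial in_keys_iff)
    qed
  qed
  then show "homogeneous \<theta> p" by (simp add: homogeneous_def)
qed

text \<open>Extendibility is applied to the two-term polynomial with words \<open>m1\<close> and
  \<open>m2\<close>. Equal words are treated apart, since in characteristic 2 their sum is
  zero.\<close>

lemma extendible_eq_context:
  assumes "extendible TYPE('a::field) \<theta>" "\<theta> m1 = \<theta> m2"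
  shows "\<theta> (l @ m1 @ r) = \<theta> (l @ m2 @ r)"
proof (cases "m1 = m2")
  case False
  define p :: "('b, 'a) ncpoly" where "p = monomial m1 + monomial m2"
  have "homogeneous \<theta> p"
  proof -
    have "Poly_Mapping.keys p \<subseteq> {m1, m2}"
      using keys_add[of "monomial m1 :: ('b, 'a) ncpoly" "monomial m2"] by (simp add: p_def insert_commute)
    then have "\<theta> m = \<theta> m2" if "m \<in> Poly_Mapping.keys p" for m
      using that assms(2) by auto
    then show ?thesis by (simp add: homogeneous_iff)
  qed
  moreover have "is_term (monomial w :: ('b, 'a) ncpoly)" for w
    unfolding is_term_def by (intro exI[of _ w] exI[of _ 1]) simp
  ultimately have "homogeneous \<theta> (monomial l * p * monomial r)"
    using assms(1) unfolding extendible_def by blast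
  moreover have "l @ m1 @ r \<in> Poly_Mapping.keys (monomial l * p * monomial r)"
    and "l @ m2 @ r \<in> Poly_Mapping.keys (monomial l * p * monomial r)"
    using False
    by (simp_all add: in_keys_iff lookup_word_mult)
      (simp_all add: p_def lookup_add lookup_single when_def)
  ultimately show ?thesis
    unfolding homogeneous_iff by blast
qed simp

text \<open>The three laws come, in this order, from \<theta> being a first ordering function, from
  strict compatibility and from extendibility.\<close>

locale graded_ordering = admissible_ordering ord for ord :: "'v monom rel" +
  fixes \<theta> :: "'v monom \<Rightarrow> int"
  assumes theta_mono: "x \<prec> y \<Longrightarrow> \<theta> x \<le> \<theta> y"
    and theta_context_less: "\<theta> x < \<theta> y \<Longrightarrow> \<theta> (l @ x @ r) < \<theta> (l @ y @ r)"
    and theta_context_eq: "\<theta> x = \<theta> y \<Longrightarrow> \<theta> (l @ x @ r) = \<theta> (l @ y @ r)"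
begin

section \<open>Initials and their behaviour under representations, reductions and
  S-polynomials\<close>

lemma theta_le_LM: "p \<noteq> 0 \<Longrightarrow> m \<in> Poly_Mapping.keys p \<Longrightarrow> \<theta> m \<le> \<theta> (LM ord p)"
  using le_LM[of p m] theta_mono[of m] by auto

lemma initial_eq_theta_part:
  assumes "p \<noteq> 0"
  shows "initial \<theta> p = theta_part \<theta> (\<theta> (LM ord p)) p"
proof (rule poly_mapping_eqI)
  fix m
  have "(\<forall>m'\<in>Poly_Mapping.keys p. \<theta> m' \<le> \<theta> m) \<longleftrightarrow> \<theta> m = \<theta> (LM ord p)"
    if "m \<in> Poly_Mapping.keys p"
    using theta_le_LM[OF assms] LM_in_keys[OF assms] that by (metis order_antisym)
  then show "Poly_Mapping.lookup (initial \<theta> p) m =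
      Poly_Mapping.lookup (theta_part \<theta> (\<theta> (LM ord p)) p) m"
    by (cases "m \<in> Poly_Mapping.keys p") (simp_all add: lookup_initial lookup_theta_part in_keys_iff)
qed

lemma keys_initial_subset: "Poly_Mapping.keys (initial \<theta> p) \<subseteq> Poly_Mapping.keys p"
proof
  show "m \<in> Poly_Mapping.keys p" if "m \<in> Poly_Mapping.keys (initial \<theta> p)" for m
    using that unfolding in_keys_iff lookup_initial by presburger
qed

lemma LM_in_keys_initial:
  assumes "p \<noteq> 0"
  shows "LM ord p \<in> Poly_Mapping.keys (initial \<theta> p)"
  using LM_in_keys[OF assms] by (simp add: initial_eq_theta_part[OF assms] in_keys_iff lookup_theta_part)

lemma initial_nonzero: "p \<noteq> 0 \<Longrightarrow> initial \<theta> p \<noteq> 0"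
  using LM_in_keys_initial by fastforce

lemma LM_initial:
  assumes "p \<noteq> 0"
  shows "LM ord (initial \<theta> p) = LM ord p"
  using LM_in_keys_initial[OF assms] keys_initial_subset[of p] le_LM[OF assms]
  by (intro LM_eqI) auto

lemma LC_initial:
  assumes "p \<noteq> 0"
  shows "LC ord (initial \<theta> p) = LC ord p"
  unfolding LC_def LM_initial[OF assms]
  by (simp add: initial_eq_theta_part[OF assms] lookup_theta_part)

text \<open>A context preserves both equality and strict inequality of \<theta>-values, so the words
  of top value in the multiple are exactly those coming from the initial of
  \<open>p\<close>.\<close>

lemma theta_part_word_mult:
  assumes "p \<noteq> 0" "\<theta> (u @ LM ord p @ v) \<le> k"
  shows "theta_part \<theta> k (word_mult u c p v) =
    (if \<theta> (u @ LM ord p @ v) = k then word_mult u c (initial \<theta> p) v else 0)"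
proof (rule poly_mapping_eqI)
  fix w
  show "Poly_Mapping.lookup (theta_part \<theta> k (word_mult u c p v)) w = Poly_Mapping.lookup
      (if \<theta> (u @ LM ord p @ v) = k then word_mult u c (initial \<theta> p) v else 0) w"
  proof (cases "\<exists>m. w = u @ m @ v")
    case True
    then obtain m where w: "w = u @ m @ v" by blast
    show ?thesis
    proof (cases "m \<in> Poly_Mapping.keys p")
      case True
      then have "\<theta> m \<le> \<theta> (LM ord p)" by (rule theta_le_LM[OF assms(1)])
      then consider "\<theta> m = \<theta> (LM ord p)" | "\<theta> m < \<theta> (LM ord p)" by linarith
      then show ?thesis
      proof cases
        case 1
        with theta_context_eq[OF this, of u v] show ?thesis
          by (simp add: w lookup_theta_part lookup_word_mult initial_eq_theta_part[OF assms(1)])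
      next
        case 2
        with theta_context_less[OF this, of u v] assms(2) show ?thesis
          by (simp add: w lookup_theta_part lookup_word_mult initial_eq_theta_part[OF assms(1)])
      qed
    next
      case False
      then show ?thesis
        by (simp add: w lookup_theta_part lookup_word_mult lookup_initial in_keys_iff)
    qed
  next
    case False
    then show ?thesis
      by (simp add: lookup_theta_part lookup_word_mult_eq_0)
  qed
qed

lemma rep_theta_part:
  assumes "rep ord G (\<lambda>m. m \<preceq> M) p"
  shows "rep ord (initial \<theta> ` G) (\<lambda>_. True) (theta_part \<theta> (\<theta> M) p)"
  using assms
proof induction
  case (add p g u v c)
  then have "\<theta> (u @ LM ord g @ v) \<le> \<theta> M"
    using theta_mono by auto
  from theta_part_word_mult[OF add(3) this]
  have "rep ord (initial \<theta> ` G) (\<lambda>_. True) (theta_part \<theta> (\<theta> M) (word_mult u c g v))"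
    using add initial_nonzero by (auto intro: rep.zero rep_word_mult)
  from rep_add[OF this add.IH] show ?case
    by (simp add: theta_part_add)
qed (simp add: rep.zero)

text \<open>If the cancelled term has value \<open>k\<close>, the projection is a step by the
  initial of the same \<open>g\<close>; if its value is smaller, the whole subtracted multiple is
  invisible at \<open>k\<close>.\<close>

lemma reduction_step_theta_part:
  assumes "reduction_step ord G p q" "\<And>m. m \<in> Poly_Mapping.keys p \<Longrightarrow> \<theta> m \<le> k"
  shows "theta_part \<theta> k q = theta_part \<theta> k p \<or>
    reduction_step ord (initial \<theta> ` G) (theta_part \<theta> k p) (theta_part \<theta> k q)"
proof -
  obtain g u v c where g: "g \<in> G" "g \<noteq> 0" "c \<noteq> 0" "c = Poly_Mapping.lookup p (u @ LM ord g @ v)"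
    and q: "q = p - word_mult u (c * inverse (LC ord g)) g v"
    using assms(1) unfolding reduction_step_def by auto
  have le: "\<theta> (u @ LM ord g @ v) \<le> k"
    using g assms(2) by (simp add: in_keys_iff)
  show ?thesis
  proof (cases "\<theta> (u @ LM ord g @ v) = k")
    case True
    then have "theta_part \<theta> k q = theta_part \<theta> k p -
        word_mult u (c * inverse (LC ord (initial \<theta> g))) (initial \<theta> g) v"
      using theta_part_word_mult[OF g(2) le] by (simp add: q theta_part_diff LC_initial[OF g(2)])
    moreover have "c = Poly_Mapping.lookup (theta_part \<theta> k p) (u @ LM ord (initial \<theta> g) @ v)"
      using True g(4) by (simp add: LM_initial[OF g(2)] lookup_theta_part)
    ultimately show ?thesis
      unfolding reduction_step_def using g initial_nonzero by blast
  next
    case False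
    then show ?thesis
      using theta_part_word_mult[OF g(2) le] by (simp add: q theta_part_diff)
  qed
qed

lemma reduces_to_0_theta_part:
  assumes "reduces_to ord G p 0" "\<And>m. m \<in> Poly_Mapping.keys p \<Longrightarrow> \<theta> m \<le> k"
  shows "reduces_to ord (initial \<theta> ` G) (theta_part \<theta> k p) 0"
proof -
  have "(reduction_step ord G)\<^sup>*\<^sup>* p 0"
    using assms(1) by (simp add: reduces_to_def)
  then show ?thesis
    unfolding reduces_to_def using assms(2)
  proof (induction rule: converse_rtranclp_induct)
    case (step p q)
    have "\<theta> m \<le> k" if "m \<in> Poly_Mapping.keys q" for m
    proof -
      obtain m' where "m' \<in> Poly_Mapping.keys p" "m \<preceq> m'"
        using reduction_step_keys[OF step(1) \<open>m \<in> Poly_Mapping.keys q\<close>] by blast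
      with step(4)[of m'] theta_mono[of m m'] show ?thesis by auto
    qed
    then have "(reduction_step ord (initial \<theta> ` G))\<^sup>*\<^sup>* (theta_part \<theta> k q) 0"
      using step(3) by simp
    with reduction_step_theta_part[OF step(1,4)] show ?case
      by (auto intro: converse_rtranclp_into_rtranclp)
  qed simp
qed

text \<open>Here \<open>k\<close> is the \<theta>-value of the overlap word. It cannot be replaced
  by that of the leading monomial of \<open>s'\<close>, which may be lower because the leading terms
  cancel; then \<open>s\<close> is 0.\<close>

lemma S_polys_initial:
  assumes "g1 \<noteq> 0" "g2 \<noteq> 0" "s \<in> S_polys ord (initial \<theta> g1) (initial \<theta> g2)"
  shows "\<exists>s'\<in>S_polys ord g1 g2. \<exists>k. s = theta_part \<theta> k s' \<and>
    (\<forall>m\<in>Poly_Mapping.keys s'. \<theta> m \<le> k)"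
proof -
  obtain l1 r1 l2 r2 where ov: "overlap (LM ord g1) (LM ord g2) l1 r1 l2 r2"
    and s: "s = word_mult l1 (LC ord g2) (initial \<theta> g1) r1 -
      word_mult l2 (LC ord g1) (initial \<theta> g2) r2"
    using assms(3) unfolding S_polys_def LM_initial[OF assms(1)] LM_initial[OF assms(2)]
      LC_initial[OF assms(1)] LC_initial[OF assms(2)] by blast
  define M where "M = l1 @ LM ord g1 @ r1"
  have M: "l2 @ LM ord g2 @ r2 = M"
    using ov by (auto simp: overlap_def M_def)
  define s' where "s' = word_mult l1 (LC ord g2) g1 r1 - word_mult l2 (LC ord g1) g2 r2"
  have "s' \<in> S_polys ord g1 g2"
    unfolding S_polys_def s'_def using ov by blast
  moreover have "s = theta_part \<theta> (\<theta> M) s'"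
    using theta_part_word_mult[OF assms(1), of l1 r1 "\<theta> M" "LC ord g2"]
      theta_part_word_mult[OF assms(2), of l2 r2 "\<theta> M" "LC ord g1"]
    by (simp add: s s'_def theta_part_diff M flip: M_def)
  moreover have "\<theta> m \<le> \<theta> M" if "m \<in> Poly_Mapping.keys s'" for m
  proof -
    have "m \<prec> M"
      using keys_cancel_less[OF assms(1,2) _ M, of l1 r1 m] that by (simp add: s'_def M_def)
    then show ?thesis by (rule theta_mono)
  qed
  ultimately show ?thesis by blast
qed

lemma groebner_basis_initial:
  assumes "wf ord" "groebner_basis ord G J"
  shows "groebner_basis ord (initial \<theta> ` G) (initial_ideal \<theta> J)"
proof -
  have J: "J = two_sided_ideal hull G"
    and S: "\<forall>p1\<in>G - {0}. \<forall>p2\<in>G - {0}. \<forall>s\<in>S_polys ord p1 p2. reduces_to ord G s 0"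
    using assms(2) by (auto simp: groebner_basis_def)
  have "initial \<theta> p \<in> two_sided_ideal hull (initial \<theta> ` G)" if "p \<in> J" for p
  proof (cases "p = 0")
    case True
    then show ?thesis by (simp add: hull_eq_rep[where ord = ord] rep.zero)
  next
    case False
    have "rep ord G (\<lambda>_. True) p"
      using that by (simp add: J hull_eq_rep[where ord = ord])
    from rep_theta_part[OF groebner_standard_rep[OF assms(1) S this False]] show ?thesis
      by (simp add: initial_eq_theta_part[OF False] hull_eq_rep[where ord = ord])
  qed
  then have "initial \<theta> ` J \<subseteq> two_sided_ideal hull (initial \<theta> ` G)"
    by blast
  from hull_mono[OF this, of two_sided_ideal]
  have "two_sided_ideal hull (initial \<theta> ` J) \<subseteq> two_sided_ideal hull (initial \<theta> ` G)"
    by simp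
  moreover have "G \<subseteq> J"
    unfolding J by (rule hull_subset)
  then have "two_sided_ideal hull (initial \<theta> ` G) \<subseteq> two_sided_ideal hull (initial \<theta> ` J)"
    by (intro hull_mono image_mono)
  ultimately have "two_sided_ideal hull (initial \<theta> ` G) = initial_ideal \<theta> J"
    by (simp add: initial_ideal_def)
  moreover have "reduces_to ord (initial \<theta> ` G) s 0"
    if "p1 \<in> initial \<theta> ` G - {0}" "p2 \<in> initial \<theta> ` G - {0}" "s \<in> S_polys ord p1 p2" for p1 p2 s
  proof -
    have "\<exists>g\<in>G. p = initial \<theta> g \<and> g \<noteq> 0" if "p \<in> initial \<theta> ` G - {0}" for p
      using that by auto
    then obtain g1 g2
      where g: "g1 \<in> G" "p1 = initial \<theta> g1" "g1 \<noteq> 0" "g2 \<in> G" "p2 = initial \<theta> g2" "g2 \<noteq> 0"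
      using \<open>p1 \<in> initial \<theta> ` G - {0}\<close> \<open>p2 \<in> initial \<theta> ` G - {0}\<close> by metis
    have "s \<in> S_polys ord (initial \<theta> g1) (initial \<theta> g2)"
      using \<open>s \<in> S_polys ord p1 p2\<close> g(2,5) by simp
    from S_polys_initial[OF g(3,6) this]
    obtain s' k where s': "s' \<in> S_polys ord g1 g2" "s = theta_part \<theta> k s'"
      "\<forall>m\<in>Poly_Mapping.keys s'. \<theta> m \<le> k"
      by blast
    have "reduces_to ord G s' 0"
      using S g s'(1) by blast
    from reduces_to_0_theta_part[OF this, of k] show ?thesis
      using s'(2,3) by simp
  qed
  ultimately show ?thesis
    unfolding groebner_basis_def by simp
qed

end

theorem proposition6p2p15:
  fixes ord ord' :: "'v::finite monom rel"
    and \<theta> :: "'v monom \<Rightarrow> int"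
    and G J :: "('v, 'a::field) ncpoly set"
  assumes "monomial_ordering ord" and "admissible ord"
    and "monomial_ordering ord'" and "admissible ord'"
    and "harmonious_via TYPE('a) \<theta> ord ord'"
    and "strictly_compatible \<theta>"
    and "two_sided_ideal J"
    and "finite G" and "groebner_basis ord G J"
  shows "groebner_basis ord (initial \<theta> ` G) (initial_ideal \<theta> J)"
proof -
  interpret admissible_ordering ord
    using assms(1,2) by unfold_locales
  obtain N \<Theta> where \<Theta>: "defines_ordering N \<Theta> ord" "\<Theta> 0 = \<theta>" and ext: "extendible TYPE('a) \<theta>"
    using assms(5) unfolding harmonious_via_def by blast
  interpret graded_ordering ord \<theta>
  proof
    fix x y l r
    show "\<theta> x \<le> \<theta> y" if less: "x \<prec> y"
    proof -
      obtain i where "\<Theta> i x < \<Theta> i y" "\<forall>j<i. \<Theta> j x = \<Theta> j y"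
        using \<Theta>(1) less unfolding defines_ordering_def by blast
      \<comment> \<open>The first index of difference is either 0, giving strict inequality of
        \<theta>, or later, giving equality.\<close>
      then show ?thesis
        unfolding \<Theta>(2)[symmetric] by (cases "i = 0") auto
    qed
    show "\<theta> (l @ x @ r) < \<theta> (l @ y @ r)" if "\<theta> x < \<theta> y"
      using assms(6) that by (auto simp: strictly_compatible_def)
    show "\<theta> (l @ x @ r) = \<theta> (l @ y @ r)" if "\<theta> x = \<theta> y"
      using extendible_eq_context[OF ext that] .
  qed
  show ?thesis
    using wf_ord assms(9) by (intro groebner_basis_initial) auto
qed

end
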